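(* Let $n\ge 2$, let $\epsilon_j=(n-j)(n-j-2)$, let $b_0,b_1,\dots,b_n\in\mathbb{Z}$, let $U,K\ge 0$ be integers, and let $a,M\ge 1$ be odd integers all of whose prime divisors are congruent to $1$ modulo $4$. Let $f_0,\dots,f_n$ be polynomials with integer coefficients in the variables $x_1,\dots,x_n$. Let $T=\{C_1,C_2,C_3\}$, where $$C_1 = \sum_{j=0}^{n-1}(-1)^{n-j+1}b_jf_j - 4K+1,\qquad C_2 = \sum_{j=0}^{n}(-1)^{n-j+1}b_jf_j - Ma^2,$$ $$C_3 = \sum_{j=0}^{n-3}(-1)^{n-j-2}\epsilon_jb_jf_j + b_{n-1}f_{n-1} - 4U+1,$$ and let $V(T)=\{P\in\mathbb{A}^n_{\mathbb{Z}} \mid C_i(P)=0 \text{ for all } C_i\in T\}$. For $P_i\in V(T)$ let $$C_{P_i}: MY^2 = b_0f_0(P_i)X^n + b_1f_1(P_i)X^{n-1} + b_2f_2(P_i)X^{n-2}+\cdots+b_nf_n(P_i),$$ and suppose that $C_{P_i}$ is a nonsingular curve of genus $g\ge 0$ with $\deg C_{P_i}=n$. If $x>1$ and $y\ge 1$ hold for all $(x,y)\in C_{P_i}(\mathbb{Z}^+)$, then $C_{P_i}(\mathbb{Z}^+) = \emptyset$, for every $P_i\in V(T)$.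
   Context: $\mathbb{A}^n_{\mathbb{Z}}=\{(a_1,\dots,a_n)\mid a_i\in\mathbb{Z}\}$. For a plane curve with integer coefficients, $C(\mathbb{Z}^+)$ denotes the set of pairs $(x,y)$ of positive integers satisfying its equation (with $X=x$, $Y=y$). Empty sums are $0$. The condition on prime divisors is vacuous for the integer $1$. *)

theory Defs
  imports "HOL-Analysis.Analysis" "HOL-Library.Poly_Mapping"
    "HOL-Computational_Algebra.Polynomial" "HOL-Number_Theory.Cong"
begin

section \<open>Integer polynomials in finitely many variables\<close>

text \<open>Exponent vectors are finitely supported functions from variable indices to exponents;
  a polynomial is a finitely supported coefficient function on exponent vectors.\<close>

type_synonym int_mpoly = "(nat \<Rightarrow>\<^sub>0 nat) \<Rightarrow>\<^sub>0 int"

definition polys_in :: "nat \<Rightarrow> int_mpoly set" where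
  "polys_in n = {p. \<forall>m \<in> Poly_Mapping.keys p. Poly_Mapping.keys m \<subseteq> {1..n}}"

definition mpoly_value :: "int_mpoly \<Rightarrow> (nat \<Rightarrow> int) \<Rightarrow> int" where
  "mpoly_value p P =
     (\<Sum>m \<in> Poly_Mapping.keys p. Poly_Mapping.lookup p m *
        (\<Prod>i \<in> Poly_Mapping.keys m. P i ^ Poly_Mapping.lookup m i))"

text \<open>Integral affine space: points are functions on \<open>{1..n}\<close>, undefined elsewhere.\<close>

definition affine_space :: "nat \<Rightarrow> (nat \<Rightarrow> int) set" where
  "affine_space n = {1..n} \<rightarrow>\<^sub>E UNIV"

definition vanishing_set :: "nat \<Rightarrow> int_mpoly set \<Rightarrow> (nat \<Rightarrow> int) set" where
  "vanishing_set n T = {P \<in> affine_space n. \<forall>C \<in> T. mpoly_value C P = 0}"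


section \<open>Affine plane curves\<close>

text \<open>A plane curve is given by a bivariate polynomial, represented as a polynomial in \<open>Y\<close>
  whose coefficients are polynomials in \<open>X\<close>.\<close>

definition poly2 :: "'a::comm_ring_1 poly poly \<Rightarrow> 'a \<Rightarrow> 'a \<Rightarrow> 'a" where
  "poly2 C x y = poly (poly C [:y:]) x"

definition curve_degree :: "int poly poly \<Rightarrow> nat" where
  "curve_degree C = Max (insert 0 {i + degree (coeff C i) | i. coeff C i \<noteq> 0})"

definition positive_integer_points :: "int poly poly \<Rightarrow> (int \<times> int) set" where
  "positive_integer_points C = {(x, y). x > 0 \<and> y > 0 \<and> poly2 C x y = 0}"

abbreviation complexify :: "int poly poly \<Rightarrow> complex poly poly" where
  "complexify C \<equiv> map_poly (map_poly of_int) C"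

definition complex_points :: "int poly poly \<Rightarrow> (complex \<times> complex) set" where
  "complex_points C = {(x, y). poly2 (complexify C) x y = 0}"

text \<open>Nonsingularity of the affine curve over \<open>\<complex>\<close>. The partial derivatives in \<open>X\<close> and \<open>Y\<close> are
  \<open>map_poly pderiv\<close> and \<open>pderiv\<close> respectively. Points at infinity are not considered: the
  projective plane closure of \<open>M Y\<^sup>2 = F(X)\<close> is always singular when \<open>deg F \<ge> 4\<close>.\<close>

definition nonsingular_curve :: "int poly poly \<Rightarrow> bool" where
  "nonsingular_curve C \<longleftrightarrow>
     \<not> (\<exists>(x, y) \<in> complex_points C.
          poly2 (map_poly pderiv (complexify C)) x y = 0 \<and> poly2 (pderiv (complexify C)) x y = 0)"

text \<open>The genus of a connected orientable surface is the maximal number of pairwise disjoint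
  simple closed curves on it that can be removed without disconnecting it. The complex points
  of a nonsingular irreducible affine curve form such a surface. They differ from the compact
  Riemann surface of the smooth projective model by finitely many punctures, which do not
  change this number, so it is the geometric genus of the curve.\<close>

definition nonseparating_loops ::
    "'a::topological_space set \<Rightarrow> nat \<Rightarrow> (nat \<Rightarrow> real \<Rightarrow> 'a) \<Rightarrow> bool" where
  "nonseparating_loops S k \<gamma> \<longleftrightarrow>
     (\<forall>i<k. simple_path (\<gamma> i) \<and> pathfinish (\<gamma> i) = pathstart (\<gamma> i) \<and> path_image (\<gamma> i) \<subseteq> S) \<and>
     (\<forall>i<k. \<forall>j<k. i \<noteq> j \<longrightarrow> path_image (\<gamma> i) \<inter> path_image (\<gamma> j) = {}) \<and>
     connected (S - (\<Union>i<k. path_image (\<gamma> i)))"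

definition surface_has_genus :: "'a::topological_space set \<Rightarrow> nat \<Rightarrow> bool" where
  "surface_has_genus S g \<longleftrightarrow> connected S \<and>
     (\<exists>\<gamma>. nonseparating_loops S g \<gamma>) \<and> (\<forall>k>g. \<nexists>\<gamma>. nonseparating_loops S k \<gamma>)"

definition has_genus :: "int poly poly \<Rightarrow> nat \<Rightarrow> bool" where
  "has_genus C g \<longleftrightarrow> surface_has_genus (complex_points C) g"


section \<open>The polynomials of the system and the curves\<close>

definition eps :: "nat \<Rightarrow> nat \<Rightarrow> int" where
  "eps n j = (int n - int j) * (int n - int j - 2)"

definition C1 :: "nat \<Rightarrow> (nat \<Rightarrow> int) \<Rightarrow> (nat \<Rightarrow> int_mpoly) \<Rightarrow> int \<Rightarrow> int_mpoly" where
  "C1 n b f K = (\<Sum>j<n. (-1) ^ (n - j + 1) * of_int (b j) * f j) - of_int (4 * K) + 1"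

definition C2 :: "nat \<Rightarrow> (nat \<Rightarrow> int) \<Rightarrow> (nat \<Rightarrow> int_mpoly) \<Rightarrow> int \<Rightarrow> int \<Rightarrow> int_mpoly" where
  "C2 n b f M a = (\<Sum>j\<le>n. (-1) ^ (n - j + 1) * of_int (b j) * f j) - of_int (M * a\<^sup>2)"

text \<open>For \<open>n \<ge> 2\<close> the range \<open>j < n - 2\<close> is \<open>0 \<le> j \<le> n - 3\<close>, and it is empty for \<open>n = 2\<close>
  (unlike \<open>{0..n - 3}\<close> with truncated subtraction).\<close>

definition C3 :: "nat \<Rightarrow> (nat \<Rightarrow> int) \<Rightarrow> (nat \<Rightarrow> int_mpoly) \<Rightarrow> int \<Rightarrow> int_mpoly" where
  "C3 n b f U = (\<Sum>j<n - 2. (-1) ^ (n - j - 2) * of_int (eps n j) * of_int (b j) * f j)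
                + of_int (b (n - 1)) * f (n - 1) - of_int (4 * U) + 1"

text \<open>The curve \<open>M Y\<^sup>2 = b\<^sub>0 f\<^sub>0(P) X\<^sup>n + \<dots> + b\<^sub>n f\<^sub>n(P)\<close>.\<close>

definition curve_at ::
    "nat \<Rightarrow> (nat \<Rightarrow> int) \<Rightarrow> (nat \<Rightarrow> int_mpoly) \<Rightarrow> int \<Rightarrow> (nat \<Rightarrow> int) \<Rightarrow> int poly poly" where
  "curve_at n b f M P =
     [: - (\<Sum>j\<le>n. monom (b j * mpoly_value (f j) P) (n - j)), 0, [:M:] :]"

end

theory Submission
  imports Defs "HOL-Number_Theory.Residues"
begin

text \<open>
  Write \<open>c\<^sub>j = b\<^sub>j f\<^sub>j(P)\<close> and \<open>F(X) = \<Sum>c\<^sub>j X\<^sup>n\<^sup>-\<^sup>j\<close>, so that the curve is \<open>M Y\<^sup>2 = F(X)\<close>. Its points with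
  positive integral coordinates are excluded modulo 4, after one multiplicative step. The equation
  \<open>C\<^sub>2(P) = 0\<close> says \<open>F(-1) = -M a\<^sup>2\<close>. Hence a point \<open>(x, y)\<close> satisfies
  \<open>M (y\<^sup>2 + a\<^sup>2) = F(x) - F(-1) = (x + 1) G\<close> for some integer \<open>G\<close>, and if \<open>x > 0\<close> both factors
  on the right are positive.

  The left side restricts its divisors severely. A prime \<open>p \<equiv> 3 (mod 4)\<close> dividing it would
  divide \<open>M\<close> or a sum of two squares, hence \<open>M\<close> or \<open>a\<close>, which the hypotheses forbid
  (\<open>odd_divisor_cong_1_mod_4\<close>). So its odd positive divisors are all \<open>\<equiv> 1 (mod 4)\<close>; and
  it is not divisible by 4, because \<open>a\<close> and \<open>M\<close> are odd. Therefore \<open>x + 1\<close> is \<open>1\<close> or \<open>2\<close> modulo 4.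

  If \<open>x \<equiv> 0 (mod 4)\<close>, then \<open>M y\<^sup>2 \<equiv> F(0) = c\<^sub>n\<close>, while \<open>C\<^sub>1(P) = C\<^sub>2(P) = 0\<close> give
  \<open>c\<^sub>n = 4K - 1 - M a\<^sup>2 \<equiv> 2\<close>. As \<open>M \<equiv> 1\<close>, this would make 2 a square modulo 4.

  If \<open>x \<equiv> 1 (mod 4)\<close>, then \<open>x + 1\<close> is even, so \<open>G\<close> must be odd and hence \<open>G \<equiv> 1\<close>. But modulo 4
  the difference quotient \<open>G\<close> is congruent to the sum of the \<open>c\<^sub>j\<close> with \<open>n - j\<close> odd
  (\<open>difference_quotient_mod_4\<close>), and that sum is what \<open>C\<^sub>3\<close> records: its signed
  weights \<open>(-1)\<^sup>n\<^sup>-\<^sup>j\<^sup>-\<^sup>2 \<epsilon>\<^sub>j\<close> are \<open>\<equiv> 0\<close> for even \<open>n - j\<close> and \<open>\<equiv> 1\<close> for odd \<open>n - j\<close> (\<open>eps_mod_4\<close>), so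
  \<open>C\<^sub>3(P) = 0\<close> gives \<open>G \<equiv> 4U - 1 \<equiv> 3\<close>.
\<close>


section \<open>Evaluation of integer polynomials\<close>

lemma mpoly_value_superset:
  assumes "finite S" "Poly_Mapping.keys p \<subseteq> S"
  shows "mpoly_value p P = (\<Sum>m\<in>S. Poly_Mapping.lookup p m *
           (\<Prod>i \<in> Poly_Mapping.keys m. P i ^ Poly_Mapping.lookup m i))"
  unfolding mpoly_value_def using assms
  by (intro sum.mono_neutral_left) (auto simp: in_keys_iff)

lemma mpoly_value_add: "mpoly_value (p + q) P = mpoly_value p P + mpoly_value q P"
proof -
  let ?S = "Poly_Mapping.keys p \<union> Poly_Mapping.keys q"
  have "finite ?S" "Poly_Mapping.keys (p + q) \<subseteq> ?S"
    using keys_add[of p q] by auto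
  then show ?thesis
    by (simp add: mpoly_value_superset[of ?S] lookup_add distrib_right sum.distrib)
qed

lemma mpoly_value_0: "mpoly_value 0 P = 0"
  by (simp add: mpoly_value_def)

lemma mpoly_value_1: "mpoly_value 1 P = 1"
  by (simp add: mpoly_value_def)

lemma mpoly_value_diff: "mpoly_value (p - q) P = mpoly_value p P - mpoly_value q P"
  using mpoly_value_add[of "p - q" q P] by simp

lemma mpoly_value_sum: "mpoly_value (\<Sum>j\<in>A. p j) P = (\<Sum>j\<in>A. mpoly_value (p j) P)"
  by (induction A rule: infinite_finite_induct) (simp_all add: mpoly_value_0 mpoly_value_add)

lemma mpoly_value_of_int_mult: "mpoly_value (of_int c * p) P = c * mpoly_value p P"
  by (induction c rule: int_induct[where k = 0])
     (simp_all add: mpoly_value_0 mpoly_value_add mpoly_value_diff distrib_right left_diff_distrib)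

lemma mpoly_value_of_int: "mpoly_value (of_int c) P = c"
  using mpoly_value_of_int_mult[of c 1 P] by (simp add: mpoly_value_1)

lemma mpoly_value_sum_of_int_mult:
  "mpoly_value (\<Sum>j\<in>A. of_int (c j) * p j) P = (\<Sum>j\<in>A. c j * mpoly_value (p j) P)"
  by (simp add: mpoly_value_sum mpoly_value_of_int_mult)

lemma mpoly_value_C1:
  "mpoly_value (C1 n b f K) P =
     (\<Sum>j<n. (-1) ^ (n - j + 1) * (b j * mpoly_value (f j) P)) - 4 * K + 1"
  using mpoly_value_sum_of_int_mult[of "\<lambda>j. (-1) ^ (n - j + 1) * b j" f "{..<n}" P]
    mpoly_value_of_int[of "4 * K" P]
  by (simp add: C1_def mpoly_value_add mpoly_value_diff mpoly_value_1 mult.assoc)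

lemma mpoly_value_C2:
  "mpoly_value (C2 n b f M a) P =
     (\<Sum>j\<le>n. (-1) ^ (n - j + 1) * (b j * mpoly_value (f j) P)) - M * a\<^sup>2"
  using mpoly_value_sum_of_int_mult[of "\<lambda>j. (-1) ^ (n - j + 1) * b j" f "{..n}" P]
    mpoly_value_of_int[of "M * a\<^sup>2" P]
  by (simp add: C2_def mpoly_value_diff mult.assoc)

lemma mpoly_value_C3:
  "mpoly_value (C3 n b f U) P =
     (\<Sum>j<n - 2. (-1) ^ (n - j - 2) * eps n j * (b j * mpoly_value (f j) P))
     + b (n - 1) * mpoly_value (f (n - 1)) P - 4 * U + 1"
  using mpoly_value_sum_of_int_mult[of "\<lambda>j. (-1) ^ (n - j - 2) * eps n j * b j" f "{..<n - 2}" P]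
    mpoly_value_of_int[of "4 * U" P]
  by (simp add: C3_def mpoly_value_add mpoly_value_diff mpoly_value_1 mpoly_value_of_int_mult
      mult.assoc)

lemma poly2_curve_at:
  "poly2 (curve_at n b f M P) x y =
     M * y\<^sup>2 - (\<Sum>j\<le>n. b j * mpoly_value (f j) P * x ^ (n - j))"
  by (simp add: poly2_def curve_at_def poly_sum poly_monom power2_eq_square)


section \<open>Divisors of \<open>M (y\<^sup>2 + a\<^sup>2)\<close> modulo 4\<close>

text \<open>This is the nonresiduosity of \<open>-1\<close>: if \<open>p\<close> divided neither number, raising
  \<open>y\<^sup>2 \<equiv> -a\<^sup>2\<close> to the odd power \<open>(p - 1)/2\<close> would turn Fermat's theorem into \<open>1 \<equiv> -1 (mod p)\<close>.\<close>

lemma prime_3_mod_4_dvd_sum_of_squares: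
  fixes p y a :: int
  assumes p: "prime p" "[p = 3] (mod 4)" and dvd: "p dvd y\<^sup>2 + a\<^sup>2"
  shows "p dvd a"
proof (rule ccontr)
  assume na: "\<not> p dvd a"
  have ny: "\<not> p dvd y"
  proof
    assume "p dvd y"
    then have "p dvd y\<^sup>2" by (simp add: power2_eq_square)
    then have "p dvd a\<^sup>2" using dvd dvd_add_right_iff by blast
    then show False using na p(1) prime_dvd_power by blast
  qed
  have fermat: "[(z\<^sup>2) ^ (nat p div 2) = 1] (mod p)" if "\<not> p dvd z" for z :: int
  proof -
    have odd: "odd (nat p)"
      using p by (auto simp: cong_def even_nat_iff prime_ge_0_int) presburger
    have "prime (nat p)" using p(1) by simp
    moreover have "\<not> nat p dvd nat \<bar>z\<bar>" using that p(1)
      by (simp add: nat_dvd_iff prime_ge_0_int)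
    ultimately have "[nat \<bar>z\<bar> ^ (nat p - 1) = 1] (mod nat p)"
      by (rule fermat_theorem)
    then have "[int (nat \<bar>z\<bar> ^ (nat p - 1)) = int 1] (mod int (nat p))"
      by (simp only: cong_int_iff)
    moreover have "nat p - 1 = 2 * (nat p div 2)" using odd by (auto elim: oddE)
    ultimately show ?thesis
      using p(1) by (simp add: power_mult prime_ge_0_int)
  qed
  have odd: "odd (nat p div 2)"
  proof -
    have "int (nat p mod 4) = int 3"
      using p by (simp add: cong_def prime_ge_0_int zmod_int)
    then have "nat p mod 4 = 3" by (simp only: of_nat_eq_iff)
    then have "nat p = 4 * (nat p div 4) + 3" by (metis mult_div_mod_eq)
    then have "nat p div 2 = 2 * (nat p div 4) + 1" by linarith
    then show ?thesis by simp
  qed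
  have "[y\<^sup>2 = - (a\<^sup>2)] (mod p)" using dvd by (simp add: cong_iff_dvd_diff)
  then have "[(y\<^sup>2) ^ (nat p div 2) = (- (a\<^sup>2)) ^ (nat p div 2)] (mod p)"
    by (rule cong_pow)
  then have "[(y\<^sup>2) ^ (nat p div 2) = - ((a\<^sup>2) ^ (nat p div 2))] (mod p)"
    using odd by simp
  moreover have "[- ((a\<^sup>2) ^ (nat p div 2)) = - 1] (mod p)"
    using fermat[OF na] by (simp add: cong_minus_minus_iff)
  ultimately have "[1 = - 1] (mod p)"
    using fermat[OF ny] by (meson cong_sym cong_trans)
  then have "p dvd 2" by (simp add: cong_iff_dvd_diff)
  then have "p \<le> 2" by (simp add: zdvd_imp_le)
  then show False using p prime_ge_2_int[of p] by (auto simp: cong_def)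
qed

lemma cong_1_mod_4_if_prime_divisors:
  fixes d :: int
  assumes "d > 0" and "\<And>p. prime p \<Longrightarrow> p dvd d \<Longrightarrow> [p = 1] (mod 4)"
  shows "[d = 1] (mod 4)"
  using assms
proof (induction d rule: prime_divisors_induct)
  case (factor p d)
  have "d > 0" using factor.prems(1) factor.hyps prime_gt_0_int[of p]
    by (simp add: zero_less_mult_iff)
  then have "[d = 1] (mod 4)" using factor.prems(2) by (intro factor.IH) auto
  moreover have "[p = 1] (mod 4)" using factor.hyps factor.prems(2) by auto
  ultimately show ?case using cong_mult[of p 1 4 d 1] by simp
qed auto

lemma odd_divisor_cong_1_mod_4:
  fixes a M y d :: int
  assumes a: "\<And>p::int. prime p \<Longrightarrow> p dvd a \<Longrightarrow> [p = 1] (mod 4)"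
    and M: "\<And>p::int. prime p \<Longrightarrow> p dvd M \<Longrightarrow> [p = 1] (mod 4)"
    and d: "d > 0" "odd d" "d dvd M * (y\<^sup>2 + a\<^sup>2)"
  shows "[d = 1] (mod 4)"
  using d(1)
proof (rule cong_1_mod_4_if_prime_divisors)
  fix p :: int
  assume p: "prime p" "p dvd d"
  show "[p = 1] (mod 4)"
  proof (rule ccontr)
    assume n1: "\<not> [p = 1] (mod 4)"
    have "odd p" using p(2) d(2) dvd_trans by blast
    with n1 have p3: "[p = 3] (mod 4)" unfolding cong_def by simp presburger
    have "p dvd M * (y\<^sup>2 + a\<^sup>2)" using p(2) d(3) dvd_trans by blast
    then have "p dvd M \<or> p dvd y\<^sup>2 + a\<^sup>2" using p(1) prime_dvd_mult_iff by blast
    then have "p dvd M \<or> p dvd a"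
      using prime_3_mod_4_dvd_sum_of_squares[OF p(1) p3] by blast
    then show False using n1 M[OF p(1)] a[OF p(1)] by blast
  qed
qed

lemma square_mod_4_int: "(z::int)\<^sup>2 mod 4 = (if odd z then 1 else 0)"
proof -
  have "z mod 4 = 0 \<or> z mod 4 = 1 \<or> z mod 4 = 2 \<or> z mod 4 = 3" by presburger
  moreover have "z\<^sup>2 mod 4 = (z mod 4)\<^sup>2 mod 4" by (simp add: power_mod)
  moreover have "odd z \<longleftrightarrow> z mod 4 = 1 \<or> z mod 4 = 3" by presburger
  ultimately show ?thesis by auto
qed


section \<open>The polynomial modulo 4\<close>

text \<open>\<open>(x\<^sup>k - (-1)\<^sup>k) / (x + 1)\<close> is the alternating sum \<open>x\<^sup>k\<^sup>-\<^sup>1 - x\<^sup>k\<^sup>-\<^sup>2 + \<dots>\<close> of \<open>k\<close> terms. For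
  \<open>x \<equiv> 1\<close> its terms cancel in pairs, up to one term if \<open>k\<close> is odd.\<close>

lemma power_difference_quotient_mod_4:
  fixes x :: int
  assumes x: "[x = 1] (mod 4)"
  shows "\<exists>q. x ^ k - (-1) ^ k = (x + 1) * q \<and> [q = of_bool (odd k)] (mod 4)"
proof (induction k)
  case 0
  show ?case by (intro exI[of _ 0]) simp
next
  case (Suc k)
  then obtain q where q: "x ^ k - (-1) ^ k = (x + 1) * q" "[q = of_bool (odd k)] (mod 4)"
    by blast
  have "x ^ Suc k - (-1) ^ Suc k = x * (x ^ k - (-1) ^ k) + (x + 1) * (-1) ^ k"
    by (simp add: algebra_simps)
  also have "\<dots> = (x + 1) * (x * q + (-1) ^ k)"
    unfolding q(1) by (simp add: algebra_simps)
  finally have "x ^ Suc k - (-1) ^ Suc k = (x + 1) * (x * q + (-1) ^ k)" .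
  moreover have "[x * q + (-1) ^ k = 1 * of_bool (odd k) + (-1) ^ k] (mod 4)"
    by (intro cong_add cong_mult x q(2) cong_refl)
  then have "[x * q + (-1) ^ k = of_bool (odd (Suc k))] (mod 4)"
    by (cases "even k") simp_all
  ultimately show ?case by blast
qed

lemma difference_quotient_mod_4:
  fixes x :: int and c :: "nat \<Rightarrow> int"
  assumes "[x = 1] (mod 4)"
  shows "\<exists>G. (\<Sum>j\<le>n. c j * x ^ (n - j)) - (\<Sum>j\<le>n. c j * (-1) ^ (n - j)) = (x + 1) * G
           \<and> [G = (\<Sum>j\<le>n. of_bool (odd (n - j)) * c j)] (mod 4)"
proof -
  obtain q where q: "\<And>k. x ^ k - (-1) ^ k = (x + 1) * q k"
    "\<And>k. [q k = of_bool (odd k)] (mod 4)"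
    using power_difference_quotient_mod_4[OF assms] by metis
  have "(\<Sum>j\<le>n. c j * x ^ (n - j)) - (\<Sum>j\<le>n. c j * (-1) ^ (n - j))
      = (\<Sum>j\<le>n. c j * (x ^ (n - j) - (-1) ^ (n - j)))"
    by (simp add: sum_subtractf right_diff_distrib)
  also have "\<dots> = (x + 1) * (\<Sum>j\<le>n. q (n - j) * c j)"
    unfolding q(1) by (simp add: sum_distrib_left mult_ac)
  finally show ?thesis
    by (intro exI[of _ "\<Sum>j\<le>n. q (n - j) * c j"] conjI cong_sum cong_mult q(2) cong_refl)
qed

text \<open>With \<open>k = n - j\<close> the weight is \<open>k (k - 2) = (k - 1)\<^sup>2 - 1\<close>: a product of two even numbers if
  \<open>k\<close> is even, one less than an even square if \<open>k\<close> is odd. For odd \<open>k\<close> the sign turns \<open>-1\<close> into \<open>1\<close>.\<close>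

lemma eps_mod_4:
  assumes "j + 2 \<le> n"
  shows "[(-1) ^ (n - j - 2) * eps n j = of_bool (odd (n - j))] (mod 4)"
proof -
  obtain k where n: "n = j + 2 + k" using assms le_Suc_ex by blast
  have eps: "eps n j = int k * int k + 2 * int k" by (simp add: eps_def n algebra_simps)
  show ?thesis
  proof (cases "even k")
    case True
    then obtain l where "k = 2 * l" by blast
    then have "eps n j = 4 * (int l * int l + int l)" by (simp add: eps)
    then show ?thesis using True by (simp add: n cong_0_iff)
  next
    case False
    then obtain l where "k = 2 * l + 1" using oddE by blast
    then have "- eps n j - 1 = 4 * (- int l * int l - 2 * int l - 1)"
      by (simp add: eps algebra_simps)
    then have "4 dvd - eps n j - 1" by (rule dvdI)
    then have "[- eps n j = 1] (mod 4)" by (simp add: cong_iff_dvd_diff)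
    then show ?thesis using False by (simp add: n)
  qed
qed

text \<open>The left side is the value of \<open>C\<^sub>3\<close> up to a constant, so \<open>C\<^sub>3 = 0\<close> prescribes the
  difference quotient modulo 4. The indices \<open>n - 2\<close> and \<open>n\<close>, absent on the left, have \<open>n - j\<close>
  even.\<close>

lemma weighted_sum_mod_4:
  fixes c :: "nat \<Rightarrow> int"
  assumes "n \<ge> 2"
  shows "[(\<Sum>j<n - 2. (-1) ^ (n - j - 2) * eps n j * c j) + c (n - 1)
        = (\<Sum>j\<le>n. of_bool (odd (n - j)) * c j)] (mod 4)"
proof -
  obtain m where n: "n = m + 2" using assms le_Suc_ex by (metis add.commute)
  have "(\<Sum>j\<le>n. of_bool (odd (n - j)) * c j)
      = (\<Sum>j<n - 2. of_bool (odd (n - j)) * c j) + c (n - 1)"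
    by (simp add: n numeral_2_eq_2 lessThan_Suc_atMost[symmetric])
  moreover have "[(\<Sum>j<n - 2. (-1) ^ (n - j - 2) * eps n j * c j)
      = (\<Sum>j<n - 2. of_bool (odd (n - j)) * c j)] (mod 4)"
    by (intro cong_sum cong_mult eps_mod_4 cong_refl) auto
  ultimately show ?thesis by (simp add: cong_add)
qed


section \<open>Absence of positive integral points\<close>

text \<open>The argument in terms of the polynomial \<open>F\<close> alone: the three equations enter as \<open>F(-1) = -M a\<^sup>2\<close>, \<open>F(0) \<equiv> 2\<close> and the congruence satisfied by the
  difference quotient at \<open>x \<equiv> 1\<close>.\<close>

lemma no_positive_solution:
  fixes a M x y :: int and c :: "nat \<Rightarrow> int"
  assumes a: "odd a" "\<And>p::int. prime p \<Longrightarrow> p dvd a \<Longrightarrow> [p = 1] (mod 4)"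
    and M: "M > 0" "odd M" "\<And>p::int. prime p \<Longrightarrow> p dvd M \<Longrightarrow> [p = 1] (mod 4)"
    and at_minus_1: "(\<Sum>j\<le>n. c j * (-1) ^ (n - j)) = - (M * a\<^sup>2)"
    and const: "[c n = 2] (mod 4)"
    and odd_part: "[(\<Sum>j\<le>n. of_bool (odd (n - j)) * c j) = 3] (mod 4)"
    and x: "x > 0"
  shows "M * y\<^sup>2 \<noteq> (\<Sum>j\<le>n. c j * x ^ (n - j))"
proof
  let ?F = "\<lambda>x. \<Sum>j\<le>n. c j * x ^ (n - j)"
  let ?N = "M * (y\<^sup>2 + a\<^sup>2)"
  assume pt: "M * y\<^sup>2 = ?F x"
  have N: "?N = ?F x - ?F (-1)" using pt at_minus_1 by (simp add: algebra_simps)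
  have divisors: "[d = 1] (mod 4)" if "d > 0" "odd d" "d dvd ?N" for d
    using odd_divisor_cong_1_mod_4[OF a(2) M(3) that] .
  have M1: "[M = 1] (mod 4)" using M by (intro divisors) auto
  \<comment> \<open>A sum of two squares, one of them odd, is 1 or 2 modulo 4.\<close>
  have not_4_dvd: "\<not> 4 dvd ?N"
  proof
    assume "4 dvd ?N"
    moreover have "coprime 4 M"
      using M(2) coprime_power_left_iff[of 2 2 M] by simp
    ultimately have "4 dvd y\<^sup>2 + a\<^sup>2" by (simp add: coprime_dvd_mult_right_iff)
    then have "(y\<^sup>2 mod 4 + a\<^sup>2 mod 4) mod 4 = 0" by (simp add: mod_add_eq)
    then show False using a(1) by (auto simp: square_mod_4_int split: if_splits)
  qed
  have "x + 1 dvd ?N"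
  proof -
    have "(x + 1) dvd x ^ k - (-1) ^ k" for k
      using power_diff_sumr2[of x k "-1"] by simp
    then have "(x + 1) dvd (\<Sum>j\<le>n. c j * (x ^ (n - j) - (-1) ^ (n - j)))"
      by (intro dvd_sum dvd_mult)
    then show ?thesis unfolding N by (simp add: sum_subtractf right_diff_distrib)
  qed
  then have not_4_dvd_x: "\<not> 4 dvd x + 1" and odd_x: "odd (x + 1) \<Longrightarrow> (x + 1) mod 4 = 1"
    using not_4_dvd dvd_trans divisors[of "x + 1"] x by (blast, simp add: cong_def)
  have "x mod 4 = 0 \<or> x mod 4 = 1"
  proof (cases "odd (x + 1)")
    case True
    from odd_x[OF this] show ?thesis by presburger
  next
    case False
    with not_4_dvd_x show ?thesis by presburger
  qed
  then consider "[x = 0] (mod 4)" | "[x = 1] (mod 4)"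
    by (auto simp: cong_def)
  then show False
  proof cases
    case 1
    have "[?F x = ?F 0] (mod 4)"
      by (intro cong_sum cong_mult cong_pow cong_refl 1)
    also have "?F 0 = (\<Sum>j\<le>n. if j = n then c j else 0)"
      by (intro sum.cong) (auto simp: power_0_left)
    also have "\<dots> = c n" by simp
    finally have "[M * y\<^sup>2 = 2] (mod 4)" using const pt cong_trans by metis
    moreover have "[M * y\<^sup>2 = 1 * y\<^sup>2] (mod 4)"
      by (intro cong_mult M1 cong_refl)
    ultimately have "y\<^sup>2 mod 4 = 2" by (simp add: cong_def)
    then show False by (simp add: square_mod_4_int split: if_splits)
  next
    case 2
    then obtain G where G: "?F x - ?F (-1) = (x + 1) * G"
      "[G = (\<Sum>j\<le>n. of_bool (odd (n - j)) * c j)] (mod 4)"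
      using difference_quotient_mod_4 by blast
    have "?N = (x + 1) * G" using N G(1) by simp
    moreover have "?N > 0"
      using M(1) a(1) by (intro mult_pos_pos add_nonneg_pos) auto
    ultimately have "G > 0" "G dvd ?N"
      using x by (simp_all add: zero_less_mult_iff)
    moreover have "[G = 3] (mod 4)" using G(2) odd_part cong_trans by blast
    moreover from this have "odd G" unfolding cong_def by simp presburger
    ultimately show False using divisors[of G] by (simp add: cong_def)
  qed
qed

theorem theorem6p1:
  fixes n g :: nat
    and b :: "nat \<Rightarrow> int"
    and f :: "nat \<Rightarrow> int_mpoly"
    and U K a M :: int
    and T :: "int_mpoly set"
    and P :: "nat \<Rightarrow> int"
  assumes "n \<ge> 2"
    and "U \<ge> 0" and "K \<ge> 0"
    and "a \<ge> 1" and "odd a" and "\<And>p::int. prime p \<Longrightarrow> p dvd a \<Longrightarrow> [p = 1] (mod 4)"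
    and "M \<ge> 1" and "odd M" and "\<And>p::int. prime p \<Longrightarrow> p dvd M \<Longrightarrow> [p = 1] (mod 4)"
    and "\<And>j. j \<le> n \<Longrightarrow> f j \<in> polys_in n"
    and "T = {C1 n b f K, C2 n b f M a, C3 n b f U}"
    and "P \<in> vanishing_set n T"
    and "nonsingular_curve (curve_at n b f M P)"
    and "has_genus (curve_at n b f M P) g"
    and "curve_degree (curve_at n b f M P) = n"
    and "\<And>x y. (x, y) \<in> positive_integer_points (curve_at n b f M P) \<Longrightarrow> x > 1 \<and> y \<ge> 1"
  shows "positive_integer_points (curve_at n b f M P) = {}"
proof -
  define c where "c j = b j * mpoly_value (f j) P" for j
  have "mpoly_value (C1 n b f K) P = 0" "mpoly_value (C2 n b f M a) P = 0"
    "mpoly_value (C3 n b f U) P = 0"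
    using assms(11,12) by (auto simp: vanishing_set_def)
  then have C1: "(\<Sum>j<n. (-1) ^ (n - j + 1) * c j) = 4 * K - 1"
    and C2: "(\<Sum>j\<le>n. (-1) ^ (n - j + 1) * c j) = M * a\<^sup>2"
    and C3: "(\<Sum>j<n - 2. (-1) ^ (n - j - 2) * eps n j * c j) + c (n - 1) = 4 * U - 1"
    by (simp_all add: mpoly_value_C1 mpoly_value_C2 mpoly_value_C3 c_def)
  have at_minus_1: "(\<Sum>j\<le>n. c j * (-1) ^ (n - j)) = - (M * a\<^sup>2)"
    using C2 by (simp add: sum_negf mult.commute)
  have "c n = 4 * K - 1 - M * a\<^sup>2"
    using C1 C2 by (simp add: lessThan_Suc_atMost[symmetric])
  moreover have "[M * a\<^sup>2 = 1 * 1] (mod 4)"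
  proof (rule cong_mult)
    show "[M = 1] (mod 4)"
      by (rule cong_1_mod_4_if_prime_divisors[OF _ assms(9)]) (use assms(7) in linarith)
    show "[a\<^sup>2 = 1] (mod 4)"
      using assms(5) by (simp add: cong_def square_mod_4_int)
  qed
  ultimately have "[c n = 4 * K - 1 - 1 * 1] (mod 4)"
    by (simp only:) (intro cong_diff cong_refl)
  also have "[4 * K - 1 - 1 * 1 = 2] (mod 4)"
    unfolding cong_def by presburger
  finally have const: "[c n = 2] (mod 4)" .
  have "[4 * U - 1 = (\<Sum>j\<le>n. of_bool (odd (n - j)) * c j)] (mod 4)"
    using weighted_sum_mod_4[OF assms(1), of c] C3 by simp
  moreover have "[4 * U - 1 = 3] (mod 4)"
    unfolding cong_def by presburger
  ultimately have odd_part: "[(\<Sum>j\<le>n. of_bool (odd (n - j)) * c j) = 3] (mod 4)"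
    using cong_sym cong_trans by blast
  have "M > 0" using assms(7) by simp
  have "poly2 (curve_at n b f M P) x y \<noteq> 0" if "x > 0" for x y
    using no_positive_solution
      [OF assms(5,6) \<open>M > 0\<close> assms(8,9) at_minus_1 const odd_part that, of y]
    by (simp add: poly2_curve_at c_def)
  then show ?thesis by (auto simp: positive_integer_points_def)
qed

end
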